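(* Consider the multivariate integration problem $$\mathrm{Int}_d\colon F_d\to\mathbb{R},\qquad f\mapsto\int_{[0,1]^d}f(x)\,\mathrm{d}x,\qquad d\in\mathbb{N},$$ where $$F_d:=\Big\{f\in C^\infty([0,1]^d) : \|f\|_{F_d}:=\sup_{k\in\mathbb{N}_0}\ \sup_{\theta\in\mathbb{S}^{d-1}}\|D_\theta^k f\|_{L_\infty([0,1]^d)}<\infty\Big\},$$ in the worst case setting with information from $\Lambda^{\mathrm{std}}$ (function values). This problem is $(s,t)$-weakly tractable whenever $s>0$ and $t>1/2$.
   Context: $\mathbb{S}^{d-1}$ is the Euclidean unit sphere in $\mathbb{R}^d$ and $D_\theta^k f$ denotes the directional derivative of $f$ of order $k$ in direction $\theta$. Information complexity. For $n\in\mathbb{N}_0$, $e(n,d)$ is the infimum, over all (deterministic, non-adaptive) linear algorithms $A$ using at most $n$ function values of $f$, of the worst case error $\sup_{\|f\|_{F_d}\le1}|\mathrm{Int}_d(f)-A(f)|$. The information complexity is $n(\epsilon,\mathrm{Int}_d):=\min\{n\in\mathbb{N}_0: e(n,d)\le\epsilon\}$. The initial error $e(0,d)$ equals $1$ for all $d$, so the absolute and normalized error criteria coincide. $(s,t)$-weak tractability. For fixed $s,t\ge0$, the problem is $(s,t)$-weakly tractable if $$\lim_{\epsilon^{-1}+d\to\infty}\frac{\ln n(\epsilon,\mathrm{Int}_d)}{\epsilon^{-s}+d^{t}}=0,$$ where the limit is taken along all sequences $((\epsilon_k,d_k))_{k\in\mathbb{N}}\subset(0,1)\times\mathbb{N}$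 with $\epsilon_k^{-1}+d_k\to\infty$. *)

theory Defs
  imports "HOL-Probability.Probability"
begin

text \<open>
  The dimension \<open>d\<close> varies inside the notion of tractability, so a point of \<open>\<real>\<^sup>d\<close> is an
  extensional function on \<open>{..<d}\<close>. Only the values of an integrand on \<open>cube d\<close> matter.
  On the extensional functions, the product topology of \<open>nat \<Rightarrow> real\<close> used by
  \<open>continuous_on\<close> is the Euclidean topology.
\<close>

definition cube :: "nat \<Rightarrow> (nat \<Rightarrow> real) set" where
  "cube d = PiE {..<d} (\<lambda>_. {0..1})"

text \<open>The Lebesgue measure on the cube; its space is \<open>cube d\<close>.\<close>

definition cube_measure :: "nat \<Rightarrow> (nat \<Rightarrow> real) measure" where
  "cube_measure d = completion (PiM {..<d} (\<lambda>_. restrict_space lborel {0..1}))"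

definition unit_sphere :: "nat \<Rightarrow> (nat \<Rightarrow> real) set" where
  "unit_sphere d = {\<theta> \<in> extensional {..<d}. L2_set \<theta> {..<d} = 1}"

text \<open>One-sided at the faces of the cube.\<close>

definition partial_deriv ::
  "nat \<Rightarrow> ((nat \<Rightarrow> real) \<Rightarrow> real) \<Rightarrow> (nat \<Rightarrow> real) \<Rightarrow> real" where
  "partial_deriv i f x = vector_derivative (\<lambda>u. f (x(i := u))) (at (x i) within {0..1})"

text \<open>
  \<open>C\<^sup>\<infinity>([0,1]\<^sup>d)\<close>: all iterated partial derivatives, indexed by words \<open>is\<close> of
  coordinates, exist and are continuous on the closed cube.
\<close>

definition smooth_on_cube :: "nat \<Rightarrow> ((nat \<Rightarrow> real) \<Rightarrow> real) \<Rightarrow> bool" where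
  "smooth_on_cube d f \<longleftrightarrow>
    (\<forall>is. set is \<subseteq> {..<d} \<longrightarrow>
       continuous_on (cube d) (foldr partial_deriv is f) \<and>
       (\<forall>x\<in>cube d. \<forall>i<d.
          (\<lambda>u. foldr partial_deriv is f (x(i := u))) differentiable (at (x i) within {0..1})))"

text \<open>
  \<open>D\<^sub>\<theta> f\<close>. This is the two-sided derivative, meaningful at interior points of the cube. Its
  values on the boundary, a null set of \<open>cube_measure d\<close>, do not affect \<open>Linf_norm\<close>.
\<close>

definition dir_deriv ::
  "nat \<Rightarrow> (nat \<Rightarrow> real) \<Rightarrow> ((nat \<Rightarrow> real) \<Rightarrow> real) \<Rightarrow> (nat \<Rightarrow> real) \<Rightarrow> real" where
  "dir_deriv d \<theta> f x = deriv (\<lambda>h. f (\<lambda>i\<in>{..<d}. x i + h * \<theta> i)) 0"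

definition Linf_norm :: "nat \<Rightarrow> ((nat \<Rightarrow> real) \<Rightarrow> real) \<Rightarrow> ereal" where
  "Linf_norm d g = esssup (cube_measure d) (\<lambda>x. ereal \<bar>g x\<bar>)"

definition F_norm :: "nat \<Rightarrow> ((nat \<Rightarrow> real) \<Rightarrow> real) \<Rightarrow> ereal" where
  "F_norm d f = (SUP k::nat. SUP \<theta>\<in>unit_sphere d. Linf_norm d ((dir_deriv d \<theta> ^^ k) f))"

definition F_space :: "nat \<Rightarrow> ((nat \<Rightarrow> real) \<Rightarrow> real) set" where
  "F_space d = {f. smooth_on_cube d f \<and> F_norm d f < \<infinity>}"

definition Int_cube :: "nat \<Rightarrow> ((nat \<Rightarrow> real) \<Rightarrow> real) \<Rightarrow> real" where
  "Int_cube d f = (LINT x|cube_measure d. f x)"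

definition linear_algorithms :: "nat \<Rightarrow> nat \<Rightarrow> (((nat \<Rightarrow> real) \<Rightarrow> real) \<Rightarrow> real) set" where
  "linear_algorithms n d =
    {A. \<exists>m\<le>n. \<exists>(a :: nat \<Rightarrow> real) (p :: nat \<Rightarrow> nat \<Rightarrow> real).
          (\<forall>j<m. p j \<in> cube d) \<and> A = (\<lambda>f. \<Sum>j<m. a j * f (p j))}"

definition worst_case_error :: "nat \<Rightarrow> (((nat \<Rightarrow> real) \<Rightarrow> real) \<Rightarrow> real) \<Rightarrow> ereal" where
  "worst_case_error d A =
    (SUP f\<in>{f \<in> F_space d. F_norm d f \<le> 1}. ereal \<bar>Int_cube d f - A f\<bar>)"

definition min_error :: "nat \<Rightarrow> nat \<Rightarrow> ereal" where
  "min_error n d = (INF A\<in>linear_algorithms n d. worst_case_error d A)"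

definition info_complexity :: "real \<Rightarrow> nat \<Rightarrow> nat" where
  "info_complexity \<epsilon> d = (LEAST n. min_error n d \<le> ereal \<epsilon>)"

text \<open>
  The first conjunct says that \<open>info_complexity \<epsilon> d\<close> is a minimum over a nonempty set;
  otherwise \<open>LEAST\<close> would be an unspecified number instead of \<open>\<infinity>\<close>.
\<close>

definition weakly_tractable :: "real \<Rightarrow> real \<Rightarrow> bool" where
  "weakly_tractable s t \<longleftrightarrow>
    (\<forall>\<epsilon> d. 0 < \<epsilon> \<and> \<epsilon> < 1 \<and> 1 \<le> d \<longrightarrow> (\<exists>n. min_error n d \<le> ereal \<epsilon>)) \<and>
    (\<forall>(\<epsilon> :: nat \<Rightarrow> real) (d :: nat \<Rightarrow> nat).
       (\<forall>k. 0 < \<epsilon> k \<and> \<epsilon> k < 1 \<and> 1 \<le> d k) \<longrightarrow>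
       filterlim (\<lambda>k. inverse (\<epsilon> k) + real (d k)) at_top sequentially \<longrightarrow>
       (\<lambda>k. ln (real (info_complexity (\<epsilon> k) (d k))) / (\<epsilon> k powr (- s) + real (d k) powr t))
         \<longlonglongrightarrow> 0)"

end

theory Submission
  imports Defs
begin

text \<open>
  The point is that derivatives are measured in all unit directions while the cube has radius
  \<open>sqrt d / 2\<close> about its centre. If \<open>f\<close> is in the unit ball, its Taylor polynomial of degree
  \<open>m\<close> at the centre therefore approximates it on the cube up to
  \<open>(sqrt d / 2) ^ (m + 1) / fact (m + 1)\<close> (\<open>taylor_expansion\<close>), and a degree of order
  \<open>sqrt d + ln (1 / \<epsilon>)\<close> makes this at most \<open>\<epsilon>\<close> (\<open>taylor_remainder_le\<close>).

  The integral of the Taylor polynomial is determined by the derivatives of \<open>f\<close> at the centre, and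
  these can be replaced by function values: there is a cubature rule that is exact on
  polynomials of degree at most \<open>m\<close> and whose points lie within distance \<open>O(h)\<close> of the centre. Its
  weights are at most of order \<open>h ^ (- m)\<close>, but the Taylor remainder at its points is of order
  \<open>h ^ (m + 1)\<close>, uniformly over the unit ball. Letting \<open>h\<close> tend to 0 shows that the minimal error
  is at most the Taylor remainder (\<open>min_error_le_taylor_remainder\<close>). The rule comes from linear
  algebra (\<open>functional_as_evaluations\<close>): a linear functional on a space of functions spanned by
  \<open>N\<close> elements is a combination of at most \<open>N\<close> point evaluations. At most \<open>(m + 1) * d ^ m\<close>
  monomials, each written as a word of coordinates, span the polynomials, and one rule is used for
  each of the \<open>m + 1\<close> homogeneous degrees.

  So the logarithm of the information complexity is at most \<open>2 * ln (m + 1) + m * ln d\<close>, that is,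
  of order \<open>(1 + ln d) * (sqrt d + ln (1 / \<epsilon>))\<close> (\<open>ln_info_complexity_le\<close>). For \<open>s > 0\<close> and
  \<open>t > 1 / 2\<close> this is of smaller order than \<open>\<epsilon> powr (- s) + d powr t\<close>.
\<close>

section \<open>Linear functionals as combinations of point evaluations\<close>

text \<open>
  The space spanned by the \<open>g i\<close> has dimension at most \<open>card I\<close>, and point evaluations span
  its dual. So every linear functional on it, given by its values \<open>L i\<close> on the \<open>g i\<close>, is a
  combination of at most \<open>card I\<close> evaluations. The assumption says that \<open>L\<close> is compatible with
  the linear relations among the \<open>g i\<close> on \<open>X\<close>, which may be linearly dependent.
  The proof is Gaussian elimination: a point \<open>y\<close> at which \<open>g k\<close> does not vanish is used to make
  all other functions vanish at \<open>y\<close>, and the induction hypothesis handles those.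
\<close>
lemma functional_as_evaluations:
  fixes g :: "'i \<Rightarrow> 'x \<Rightarrow> real" and L :: "'i \<Rightarrow> real"
  assumes "finite I"
    and "\<And>c. (\<And>x. x \<in> X \<Longrightarrow> (\<Sum>i\<in>I. c i * g i x) = 0) \<Longrightarrow> (\<Sum>i\<in>I. c i * L i) = 0"
  shows "\<exists>P a. finite P \<and> P \<subseteq> X \<and> card P \<le> card I \<and> (\<forall>i\<in>I. (\<Sum>x\<in>P. a x * g i x) = L i)"
  using assms
proof (induction I arbitrary: g L rule: finite_induct)
  case empty
  show ?case by (intro exI[of _ "{}"]) auto
next
  case (insert k I)
  show ?case
  proof (cases "\<forall>x\<in>X. g k x = 0")
    case True
    have "L k = 0"
    proof -
      have "(\<Sum>i\<in>insert k I. (if i = k then 1 else 0) * L i) = 0"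
      proof (rule insert.prems)
        fix x assume "x \<in> X"
        then show "(\<Sum>i\<in>insert k I. (if i = k then 1 else 0) * g i x) = 0"
          using True insert.hyps by (auto intro!: sum.neutral)
      qed
      moreover have "(\<Sum>i\<in>I. (if i = k then 1 else 0) * L i) = 0"
        using insert.hyps by (intro sum.neutral) auto
      ultimately show ?thesis using insert.hyps by simp
    qed
    have "\<exists>P a. finite P \<and> P \<subseteq> X \<and> card P \<le> card I \<and> (\<forall>i\<in>I. (\<Sum>x\<in>P. a x * g i x) = L i)"
    proof (rule insert.IH)
      fix c :: "'i \<Rightarrow> real" assume c: "\<And>x. x \<in> X \<Longrightarrow> (\<Sum>i\<in>I. c i * g i x) = 0"
      have "(\<Sum>i\<in>insert k I. c i * L i) = 0"
        by (rule insert.prems) (use c True insert.hyps in auto)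
      then show "(\<Sum>i\<in>I. c i * L i) = 0" using \<open>L k = 0\<close> insert.hyps by simp
    qed
    then obtain P a where P: "finite P" "P \<subseteq> X" "card P \<le> card I" 
      "\<And>i. i \<in> I \<Longrightarrow> (\<Sum>x\<in>P. a x * g i x) = L i" by blast
    have "(\<Sum>x\<in>P. a x * g k x) = L k"
      using True P(2) \<open>L k = 0\<close> by (auto intro!: sum.neutral)
    then show ?thesis using P insert.hyps by (intro exI[of _ P] exI[of _ a]) auto
  next
    case False
    then obtain y where y: "y \<in> X" "g k y \<noteq> 0" by auto
    \<comment> \<open>Subtract multiples of \<open>g k\<close> so that the remaining functions vanish at \<open>y\<close>;
      the weight at \<open>y\<close> then affects none of them and is free to match \<open>L k\<close>.\<close>
    define r where "r = (\<lambda>i. g i y / g k y)"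
    define g' where "g' = (\<lambda>i x. g i x - r i * g k x)"
    define L' where "L' = (\<lambda>i. L i - r i * L k)"
    have g'y: "g' i y = 0" for i using y by (simp add: g'_def r_def)
    have "\<exists>P a. finite P \<and> P \<subseteq> X \<and> card P \<le> card I \<and> (\<forall>i\<in>I. (\<Sum>x\<in>P. a x * g' i x) = L' i)"
    proof (rule insert.IH)
      fix c :: "'i \<Rightarrow> real" assume c: "\<And>x. x \<in> X \<Longrightarrow> (\<Sum>i\<in>I. c i * g' i x) = 0"
      define c' where "c' = c(k := - (\<Sum>i\<in>I. c i * r i))"
      have c': "(\<Sum>i\<in>insert k I. c' i * z i) = (\<Sum>i\<in>I. c i * (z i - r i * z k))" for z
      proof -
        have "(\<Sum>i\<in>I. c' i * z i) = (\<Sum>i\<in>I. c i * z i)"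
          using insert.hyps by (intro sum.cong) (auto simp: c'_def)
        then show ?thesis using insert.hyps
          by (simp add: c'_def sum_subtractf algebra_simps sum_distrib_left)
      qed
      have "(\<Sum>i\<in>insert k I. c' i * L i) = 0"
        by (rule insert.prems) (use c in \<open>simp only: c' g'_def\<close>)
      then show "(\<Sum>i\<in>I. c i * L' i) = 0" by (simp only: c' L'_def)
    qed
    then obtain P a where P: "finite P" "P \<subseteq> X" "card P \<le> card I" 
      "\<And>i. i \<in> I \<Longrightarrow> (\<Sum>x\<in>P. a x * g' i x) = L' i" by blast
    \<comment> \<open>The induction hypothesis may itself use the point \<open>y\<close>, where it has no effect.\<close>
    define Q where "Q = P - {y}"
    define b where "b = (L k - (\<Sum>x\<in>Q. a x * g k x)) / g k y"
    define a' where "a' = a(y := b)"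
    have Q: "(\<Sum>x\<in>Q. a x * g' i x) = L' i" if "i \<in> I" for i
      using P(4)[OF that] P(1) g'y unfolding Q_def by (simp add: sum_diff1)
    have sum_a': "(\<Sum>x\<in>insert y Q. a' x * z x) = b * z y + (\<Sum>x\<in>Q. a x * z x)" for z
    proof -
      have "(\<Sum>x\<in>Q. a' x * z x) = (\<Sum>x\<in>Q. a x * z x)"
        by (intro sum.cong) (auto simp: a'_def Q_def)
      moreover have "finite Q" "y \<notin> Q" "a' y = b" using P(1) by (auto simp: Q_def a'_def)
      ultimately show ?thesis by simp
    qed
    have k: "b * g k y = L k - (\<Sum>x\<in>Q. a x * g k x)" using y by (simp add: b_def)
    have "(\<Sum>x\<in>insert y Q. a' x * g i x) = L i" if "i \<in> insert k I" for i
    proof (cases "i = k")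
      case True
      then show ?thesis by (simp add: sum_a' k)
    next
      case False
      with that have i: "i \<in> I" by auto
      have "(\<Sum>x\<in>Q. a x * g i x) = L i - r i * L k + r i * (\<Sum>x\<in>Q. a x * g k x)"
        using Q[OF i] by (simp add: g'_def L'_def sum_subtractf algebra_simps sum_distrib_left)
      moreover have "b * g i y = r i * (b * g k y)" using y by (simp add: r_def)
      ultimately show ?thesis by (simp only: sum_a' k) (simp add: algebra_simps)
    qed
    moreover have "card (insert y Q) \<le> card (insert k I)"
    proof -
      have "card Q \<le> card P" unfolding Q_def by (rule card_Diff1_le)
      moreover have "finite Q" using P(1) by (simp add: Q_def)
      ultimately show ?thesis using P(3) insert.hyps by (simp add: card_insert_if)
    qed
    ultimately show ?thesis using P y
      by (intro exI[of _ "insert y Q"] exI[of _ a']) (auto simp: Q_def)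
  qed
qed

section \<open>Smooth functions on the cube\<close>

lemma tendsto_coordinatewise:
  fixes F :: "'a \<Rightarrow> 'b \<Rightarrow> 'c::topological_space"
  shows "(F \<longlongrightarrow> l) net \<longleftrightarrow> (\<forall>i. ((\<lambda>z. F z i) \<longlongrightarrow> l i) net)"
  using limitin_componentwise[where X="\<lambda>_. euclidean" and I=UNIV and f=F and l=l and F=net]
  by (simp add: euclidean_product_topology)

definition opencube :: "nat \<Rightarrow> (nat \<Rightarrow> real) set" where
  "opencube d = PiE {..<d} (\<lambda>_. {0<..<1})"

lemma opencube_subset: "opencube d \<subseteq> cube d"
  unfolding opencube_def cube_def by (rule PiE_mono) auto

lemma smooth_foldr:
  assumes "smooth_on_cube d f" "set w \<subseteq> {..<d}"
  shows "smooth_on_cube d (foldr partial_deriv w f)"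
  unfolding smooth_on_cube_def
proof (intro allI impI)
  fix v assume "set v \<subseteq> {..<d}"
  then have "set (v @ w) \<subseteq> {..<d}" using assms(2) by simp
  then show "continuous_on (cube d) (foldr partial_deriv v (foldr partial_deriv w f)) \<and>
       (\<forall>x\<in>cube d. \<forall>i<d.
          (\<lambda>u. foldr partial_deriv v (foldr partial_deriv w f) (x(i := u))) differentiable (at (x i) within {0..1}))"
    using assms(1) unfolding smooth_on_cube_def foldr_append[symmetric, unfolded comp_def] 
    by (metis foldr_append comp_apply)
qed

lemma smooth_continuous: "smooth_on_cube d f \<Longrightarrow> continuous_on (cube d) f"
  unfolding smooth_on_cube_def by (metis empty_set foldr_Nil empty_subsetI id_apply)

text \<open>
  In the open cube the one-sided derivatives of the definition are ordinary derivatives.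
\<close>
lemma smooth_partial:
  assumes "smooth_on_cube d f" "x \<in> opencube d" "i < d"
  shows "((\<lambda>u. f (x(i := u))) has_real_derivative partial_deriv i f x) (at (x i))"
proof -
  have "(\<lambda>u. foldr partial_deriv [] f (x(i := u))) differentiable (at (x i) within {0..1})"
    using assms opencube_subset unfolding smooth_on_cube_def by (metis empty_set empty_subsetI subsetD)
  then have "((\<lambda>u. f (x(i := u))) has_vector_derivative partial_deriv i f x) (at (x i) within {0..1})"
    unfolding partial_deriv_def vector_derivative_works by simp
  moreover have "at (x i) within {0..1} = at (x i)"
    using assms by (intro at_within_interior) (auto simp: opencube_def PiE_iff)
  ultimately show ?thesis by (simp add: has_real_derivative_iff_has_vector_derivative)
qed

text \<open>
  Coordinates outside \<open>{..<d}\<close> have the same value at all points of the cube, so convergence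
  of the first \<open>d\<close> coordinates is enough.
\<close>
lemma continuous_tendsto_cube:
  assumes "continuous_on (cube d) f" "x \<in> cube d" "eventually (\<lambda>z. F z \<in> cube d) net"
    "\<And>i. i < d \<Longrightarrow> ((\<lambda>z. F z i) \<longlongrightarrow> x i) net"
  shows "((\<lambda>z. f (F z)) \<longlongrightarrow> f x) net"
proof (rule continuous_on_tendsto_compose[OF assms(1) _ assms(2,3)])
  show "(F \<longlongrightarrow> x) net" unfolding tendsto_coordinatewise
  proof
    fix i show "((\<lambda>z. F z i) \<longlongrightarrow> x i) net"
    proof (cases "i < d")
      case False
      have "eventually (\<lambda>z. F z i = x i) net"
        using assms(3) by eventually_elim (use False assms(2) in \<open>auto simp: cube_def PiE_iff extensional_def\<close>)
      then show ?thesis by (rule tendsto_eventually)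
    qed (use assms in auto)
  qed
qed

section \<open>Derivatives along lines\<close>

abbreviation line :: "nat \<Rightarrow> (nat \<Rightarrow> real) \<Rightarrow> (nat \<Rightarrow> real) \<Rightarrow> real \<Rightarrow> nat \<Rightarrow> real" where
  "line d x \<theta> h \<equiv> (\<lambda>i\<in>{..<d}. x i + h * \<theta> i)"

text \<open>
  The factor \<open>\<tau>\<close> covers the intermediate points that the mean value theorem produces.
\<close>
lemma eventually_line_opencube:
  assumes "x \<in> opencube d"
  shows "eventually (\<lambda>h. \<forall>i<d. \<forall>\<tau>\<in>{0..1}. x i + \<tau> * (h * \<theta> i) \<in> {0<..<1}) (nhds 0)"
proof -
  have "eventually (\<lambda>h. \<forall>\<tau>\<in>{0..1}. x i + \<tau> * (h * \<theta> i) \<in> {0<..<1}) (nhds 0)" if "i < d" for i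
  proof -
    have xi: "0 < x i" "x i < 1" using assms that by (auto simp: opencube_def PiE_iff)
    have "((\<lambda>h. \<bar>h * \<theta> i\<bar>) \<longlongrightarrow> \<bar>0 * \<theta> i\<bar>) (nhds 0)"
      by (intro tendsto_intros filterlim_ident)
    then have "eventually (\<lambda>h. \<bar>h * \<theta> i\<bar> < min (x i) (1 - x i)) (nhds 0)"
      by (rule order_tendstoD) (use xi in auto)
    then show ?thesis
    proof eventually_elim
      case (elim h)
      show ?case
      proof
        fix \<tau> :: real assume "\<tau> \<in> {0..1}"
        then have "\<bar>\<tau> * (h * \<theta> i)\<bar> \<le> \<bar>h * \<theta> i\<bar>"
          by (simp add: abs_mult mult_left_le_one_le)
        with elim show "x i + \<tau> * (h * \<theta> i) \<in> {0<..<1}" by auto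
      qed
    qed
  qed
  then have "eventually (\<lambda>h. \<forall>i\<in>{..<d}. \<forall>\<tau>\<in>{0..1}. x i + \<tau> * (h * \<theta> i) \<in> {0<..<1}) (nhds 0)"
    by (intro eventually_ball_finite) auto
  then show ?thesis by (rule eventually_mono) auto
qed

text \<open>
  The chain rule for a function with continuous partial derivatives. The increment along
  \<open>\<theta>\<close> is split into steps parallel to the axes, and the mean value theorem, applied to each step,
  replaces it by a partial derivative at a point that converges to \<open>x\<close>.
\<close>
lemma has_derivative_line_0:
  assumes f: "smooth_on_cube d f" and x: "x \<in> opencube d"
  shows "((\<lambda>h. f (line d x \<theta> h)) has_real_derivative (\<Sum>i<d. \<theta> i * partial_deriv i f x)) (at 0)"
proof -
  \<comment> \<open>\<open>Y j h\<close> is \<open>x\<close> after the steps along the first \<open>j\<close> axes.\<close>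
  define Y where "Y = (\<lambda>j h. \<lambda>i\<in>{..<d}. if i < j then x i + h * \<theta> i else x i)"
  define good where "good = (\<lambda>h. \<forall>i<d. \<forall>\<tau>\<in>{0..1}. x i + \<tau> * (h * \<theta> i) \<in> {0<..<1})"
  have good: "eventually good (at 0)"
    using eventually_line_opencube[OF x, of \<theta>] unfolding good_def
    by (rule eventually_nhds_conv_at[THEN iffD1, THEN conjunct1])
  have xi: "x i \<in> {0<..<1}" if "i < d" for i using x that by (auto simp: opencube_def PiE_iff)
  have Y0: "Y 0 h = x" for h
    using x by (auto simp: Y_def opencube_def PiE_iff extensional_def)
  have "((\<lambda>h. (f (Y j h) - f x) / h) \<longlongrightarrow> (\<Sum>i<j. \<theta> i * partial_deriv i f x)) (at 0)" if "j \<le> d" for j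
    using that
  proof (induction j)
    case 0
    then show ?case by (simp add: Y0)
  next
    case (Suc j)
    then have j: "j < d" by simp
    have "\<exists>\<tau>. 0 < \<tau> \<and> \<tau> < 1 \<and> (Y j h)(j := x j + \<tau> * (h * \<theta> j)) \<in> opencube d \<and> 
       f (Y (Suc j) h) - f (Y j h) = (h * \<theta> j) * partial_deriv j f ((Y j h)(j := x j + \<tau> * (h * \<theta> j)))"
      if h: "good h" for h
    proof -
      have mem: "(Y j h)(j := x j + \<tau> * (h * \<theta> j)) \<in> opencube d" if "\<tau> \<in> {0..1}" for \<tau>
      proof -
        have "x i + 1 * (h * \<theta> i) \<in> {0<..<1}" if "i < d" for i
          using h that unfolding good_def by (meson atLeastAtMost_iff order_refl zero_le_one)
        moreover have "x j + \<tau> * (h * \<theta> j) \<in> {0<..<1}"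
          using h that j unfolding good_def by blast
        ultimately show ?thesis
          using xi j by (auto simp: opencube_def Y_def PiE_iff extensional_def)
      qed
      \<comment> \<open>The step is parametrized by \<open>[0, 1]\<close>, so the sign of \<open>h * \<theta> j\<close> does not matter.\<close>
      have "\<exists>\<tau>>0. \<tau> < 1 \<and> f ((Y j h)(j := x j + 1 * (h * \<theta> j))) - f ((Y j h)(j := x j + 0 * (h * \<theta> j))) =
         (1 - 0) * (partial_deriv j f ((Y j h)(j := x j + \<tau> * (h * \<theta> j))) * (h * \<theta> j))"
      proof (rule MVT2)
        fix \<tau> :: real assume "0 \<le> \<tau>" "\<tau> \<le> 1"
        then have "(Y j h)(j := x j + \<tau> * (h * \<theta> j)) \<in> opencube d" by (intro mem) auto
        from smooth_partial[OF f this j]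
        have "((\<lambda>u. f ((Y j h)(j := u))) has_real_derivative
           partial_deriv j f ((Y j h)(j := x j + \<tau> * (h * \<theta> j)))) (at (x j + \<tau> * (h * \<theta> j)))"
          by simp
        then show "((\<lambda>\<tau>. f ((Y j h)(j := x j + \<tau> * (h * \<theta> j)))) has_real_derivative
          partial_deriv j f ((Y j h)(j := x j + \<tau> * (h * \<theta> j))) * (h * \<theta> j)) (at \<tau>)"
          by (rule DERIV_chain2) (auto intro!: derivative_eq_intros)
      qed simp
      moreover have "(Y j h)(j := x j + 1 * (h * \<theta> j)) = Y (Suc j) h"
        using j by (auto simp: Y_def fun_eq_iff)
      moreover have "(Y j h)(j := x j + 0 * (h * \<theta> j)) = Y j h"
        using j by (auto simp: Y_def fun_eq_iff)
      ultimately show ?thesis using mem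
        by (metis atLeastAtMost_iff less_imp_le mult.commute mult_1 diff_zero)
    qed
    then obtain \<tau> where \<tau>: "\<And>h. good h \<Longrightarrow> 0 < \<tau> h \<and> \<tau> h < 1 \<and> 
        (Y j h)(j := x j + \<tau> h * (h * \<theta> j)) \<in> opencube d \<and> 
       f (Y (Suc j) h) - f (Y j h) = (h * \<theta> j) * partial_deriv j f ((Y j h)(j := x j + \<tau> h * (h * \<theta> j)))"
      by metis
    define Z where "Z = (\<lambda>h. (Y j h)(j := x j + \<tau> h * (h * \<theta> j)))"
    have lin: "((\<lambda>h. h * \<theta> i) \<longlongrightarrow> 0) (at 0)" for i by (auto intro!: tendsto_eq_intros)
    have "((\<lambda>h. partial_deriv j f (Z h)) \<longlongrightarrow> partial_deriv j f x) (at 0)"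
    proof (rule continuous_tendsto_cube[where f = "partial_deriv j f" and F = Z])
      show "continuous_on (cube d) (partial_deriv j f)"
        using smooth_continuous[OF smooth_foldr[OF f, of "[j]"]] j by simp
      show "x \<in> cube d" using x opencube_subset by blast
      show "eventually (\<lambda>h. Z h \<in> cube d) (at 0)"
        using good by eventually_elim (use \<tau> opencube_subset in \<open>auto simp: Z_def\<close>)
      fix i assume i: "i < d"
      show "((\<lambda>h. Z h i) \<longlongrightarrow> x i) (at 0)"
      proof (cases "i = j")
        case True
        have "((\<lambda>h. \<tau> h * (h * \<theta> j)) \<longlongrightarrow> 0) (at 0)"
        proof (rule Lim_null_comparison)
          show "eventually (\<lambda>h. norm (\<tau> h * (h * \<theta> j)) \<le> \<bar>h * \<theta> j\<bar>) (at 0)"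
            using good
          proof eventually_elim
            case (elim h)
            then show ?case using \<tau>[OF elim] by (simp add: abs_mult mult_left_le_one_le)
          qed
          show "((\<lambda>h. \<bar>h * \<theta> j\<bar>) \<longlongrightarrow> 0) (at 0)" using lin[of j] by (rule tendsto_rabs_zero)
        qed
        then have "((\<lambda>h. x j + \<tau> h * (h * \<theta> j)) \<longlongrightarrow> x j + 0) (at 0)" by (intro tendsto_intros)
        then show ?thesis using True by (simp add: Z_def)
      next
        case False
        have "((\<lambda>h. x i + h * \<theta> i) \<longlongrightarrow> x i + 0) (at 0)" by (intro tendsto_intros lin)
        then show ?thesis using False i by (cases "i < j") (simp_all add: Z_def Y_def)
      qed
    qed
    then have "((\<lambda>h. \<theta> j * partial_deriv j f (Z h)) \<longlongrightarrow> \<theta> j * partial_deriv j f x) (at 0)"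
      by (intro tendsto_intros)
    moreover have "eventually (\<lambda>h. \<theta> j * partial_deriv j f (Z h) = (f (Y (Suc j) h) - f (Y j h)) / h) (at 0)"
      using good eventually_at_ball'[of 1 0 UNIV, simplified]
      by (auto elim!: eventually_elim2 simp: Z_def \<tau>)
    ultimately have "((\<lambda>h. (f (Y (Suc j) h) - f (Y j h)) / h) \<longlongrightarrow> \<theta> j * partial_deriv j f x) (at 0)"
      by (rule Lim_transform_eventually)
    from tendsto_add[OF Suc.IH this] j show ?case
      by (simp add: add_divide_distrib[symmetric])
  qed
  from this[of d] have "((\<lambda>h. (f (Y d h) - f x) / h) \<longlongrightarrow> (\<Sum>i<d. \<theta> i * partial_deriv i f x)) (at 0)" by simp
  moreover have "Y d = line d x \<theta>" by (auto simp: Y_def fun_eq_iff)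
  moreover have "line d x \<theta> 0 = x" using x by (auto simp: opencube_def PiE_iff extensional_def)
  ultimately show ?thesis by (simp add: DERIV_def)
qed

lemma has_derivative_line:
  assumes f: "smooth_on_cube d f" and x: "line d x \<theta> u \<in> opencube d"
  shows "((\<lambda>h. f (line d x \<theta> h)) has_real_derivative (\<Sum>i<d. \<theta> i * partial_deriv i f (line d x \<theta> u))) (at u)"
proof -
  have "line d (line d x \<theta> u) \<theta> h = line d x \<theta> (h + u)" for h
    by (auto simp: fun_eq_iff algebra_simps)
  then have "((\<lambda>h. f (line d x \<theta> (h + u))) has_real_derivative
      (\<Sum>i<d. \<theta> i * partial_deriv i f (line d x \<theta> u))) (at 0)"
    using has_derivative_line_0[OF f x, of \<theta>] by simp
  then show ?thesis using DERIV_shift[of "\<lambda>h. f (line d x \<theta> h)" _ 0 u] by simp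
qed

text \<open>
  Words index the partial derivatives of order \<open>k\<close> because differentiation along a line turns
  the term of the word \<open>w\<close> into the terms of the words \<open>i # w\<close>. There are more of them than
  multi-indices, but only the logarithm of their number \<open>d ^ k\<close> enters the complexity.
\<close>
definition words :: "nat \<Rightarrow> nat \<Rightarrow> nat list set" where
  "words d k = {w. set w \<subseteq> {..<d} \<and> length w = k}"

lemma finite_words [simp]: "finite (words d k)"
  unfolding words_def by (rule finite_lists_length_eq) simp

text \<open>
  The homogeneous form of degree \<open>k\<close> in \<open>\<theta>\<close> to which the \<open>k\<close>-th derivative of \<open>f\<close> in the
  direction \<open>\<theta>\<close> expands.
\<close>
definition dir_form :: "nat \<Rightarrow> (nat \<Rightarrow> real) \<Rightarrow> nat \<Rightarrow> ((nat \<Rightarrow> real) \<Rightarrow> real) \<Rightarrow> (nat \<Rightarrow> real) \<Rightarrow> real" where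
  "dir_form d \<theta> k f x = (\<Sum>w\<in>words d k. prod_list (map \<theta> w) * foldr partial_deriv w f x)"

lemma sum_words_Suc: "(\<Sum>w\<in>words d (Suc k). F w) = (\<Sum>w\<in>words d k. \<Sum>i<d. F (i # w))"
proof -
  have "words d (Suc k) = (\<lambda>(w, i). i # w) ` (words d k \<times> {..<d})"
    unfolding words_def by (rule lists_length_Suc_eq)
  moreover have "inj_on (\<lambda>(w, i). i # w) (words d k \<times> {..<d})" by (auto simp: inj_on_def)
  ultimately have "(\<Sum>w\<in>words d (Suc k). F w) = (\<Sum>(w, i)\<in>words d k \<times> {..<d}. F (i # w))"
    by (simp add: sum.reindex case_prod_unfold)
  then show ?thesis by (simp add: sum.cartesian_product)
qed

lemma dir_form_0 [simp]: "dir_form d \<theta> 0 f x = f x"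
proof -
  have "words d 0 = {[]}" by (auto simp: words_def)
  then show ?thesis by (simp add: dir_form_def)
qed

lemma has_derivative_dir_form:
  assumes f: "smooth_on_cube d f" and x: "line d x \<theta> u \<in> opencube d"
  shows "((\<lambda>h. dir_form d \<theta> k f (line d x \<theta> h)) has_real_derivative dir_form d \<theta> (Suc k) f (line d x \<theta> u)) (at u)"
proof -
  have "((\<lambda>h. dir_form d \<theta> k f (line d x \<theta> h)) has_real_derivative 
     (\<Sum>w\<in>words d k. prod_list (map \<theta> w) * (\<Sum>i<d. \<theta> i * partial_deriv i (foldr partial_deriv w f) (line d x \<theta> u)))) (at u)"
    unfolding dir_form_def
    by (intro DERIV_sum DERIV_cmult has_derivative_line[OF smooth_foldr[OF f]] x) (auto simp: words_def)
  then show ?thesis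
    by (simp add: dir_form_def sum_words_Suc sum_distrib_left mult.assoc mult.left_commute)
qed

text \<open>
  The identity is confined to the open cube, where \<open>dir_deriv\<close> is the true derivative. As the
  open cube is a neighbourhood of each of its points along every line, the next derivative depends
  on no other values, and the induction goes through.
\<close>
lemma dir_deriv_funpow:
  assumes f: "smooth_on_cube d f" and x: "x \<in> opencube d"
  shows "(dir_deriv d \<theta> ^^ k) f x = dir_form d \<theta> k f x"
  using x
proof (induction k arbitrary: x)
  case (Suc k)
  have "eventually (\<lambda>h. line d x \<theta> h \<in> opencube d) (nhds 0)"
    using eventually_line_opencube[OF Suc.prems, of \<theta>]
  proof eventually_elim
    case (elim h)
    then have "\<forall>i<d. x i + 1 * (h * \<theta> i) \<in> {0<..<1}" by (meson atLeastAtMost_iff order_refl zero_le_one)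
    then show ?case by (auto simp: opencube_def)
  qed
  then have "eventually (\<lambda>h. (dir_deriv d \<theta> ^^ k) f (line d x \<theta> h) = dir_form d \<theta> k f (line d x \<theta> h)) (nhds 0)"
    by eventually_elim (rule Suc.IH)
  then have "(dir_deriv d \<theta> ^^ Suc k) f x = deriv (\<lambda>h. dir_form d \<theta> k f (line d x \<theta> h)) 0"
    unfolding funpow.simps comp_apply dir_deriv_def[of _ _ "(dir_deriv d \<theta> ^^ k) f"]
    by (intro deriv_cong_ev) auto
  also have "line d x \<theta> 0 = x" using Suc.prems by (auto simp: opencube_def PiE_iff extensional_def)
  then have "deriv (\<lambda>h. dir_form d \<theta> k f (line d x \<theta> h)) 0 = dir_form d \<theta> (Suc k) f x"
    using has_derivative_dir_form[OF f, where x = x and \<theta> = \<theta> and u = 0 and k = k] Suc.prems by (intro DERIV_imp_deriv) simp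
  finally show ?case .
qed simp

lemma continuous_dir_form:
  assumes f: "smooth_on_cube d f" shows "continuous_on (cube d) (dir_form d \<theta> k f)"
  unfolding dir_form_def
  by (intro continuous_intros smooth_continuous[OF smooth_foldr[OF f]]) (auto simp: words_def)

lemma dir_form_scale:
  "dir_form d (\<lambda>i. r * \<theta> i) k f x = r ^ k * dir_form d \<theta> k f x"
proof -
  have "prod_list (map (\<lambda>i. r * \<theta> i) w) = r ^ length w * prod_list (map \<theta> w)" for w
    by (induction w) auto
  then show ?thesis by (simp add: dir_form_def sum_distrib_left words_def mult.assoc)
qed

lemma dir_form_cong:
  assumes "\<And>i. i < d \<Longrightarrow> \<theta> i = \<eta> i"
  shows "dir_form d \<theta> k f x = dir_form d \<eta> k f x"
  unfolding dir_form_def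
proof (rule sum.cong[OF refl])
  fix w assume "w \<in> words d k"
  then have "map \<theta> w = map \<eta> w" using assms by (auto simp: words_def)
  then show "prod_list (map \<theta> w) * foldr partial_deriv w f x = prod_list (map \<eta> w) * foldr partial_deriv w f x"
    by (simp only:)
qed

section \<open>Pointwise bounds from the norm\<close>

lemma prob_space_unit_interval: "prob_space (restrict_space lborel {0..1::real})"
  by (rule prob_space_restrict_space) auto

lemma finite_product_prob_space_cube:
  "finite_product_prob_space (\<lambda>_. restrict_space lborel {0..1::real}) {..<d::nat}"
proof -
  interpret product_prob_space "\<lambda>_::nat. restrict_space lborel {0..1::real}" "{..<d}"
    by (rule product_prob_spaceI) (rule prob_space_unit_interval)
  show ?thesis by unfold_locales simp
qed

lemma space_cube_measure [simp]: "space (cube_measure d) = cube d"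
  by (simp add: cube_measure_def cube_def space_PiM space_restrict_space)

lemma prob_space_cube_measure: "prob_space (cube_measure d)"
proof -
  interpret finite_product_prob_space "\<lambda>_::nat. restrict_space lborel {0..1::real}" "{..<d}"
    by (rule finite_product_prob_space_cube)
  show ?thesis unfolding cube_measure_def
    by (intro prob_spaceI) (simp add: emeasure_completion emeasure_space_1 del: space_PiM)
qed

text \<open>
  Boxes with one corner at \<open>x\<close> and side lengths tending to 0 have positive measure, so each
  contains a point at which the property holds. A box extends only in the direction of increasing
  coordinates, which keeps its side lengths explicit.
\<close>
lemma AE_cube_dense:
  assumes AE: "AE x in cube_measure d. P x" and x: "x \<in> opencube d"
  shows "\<exists>Y. (\<forall>n. Y n \<in> opencube d \<and> P (Y n)) \<and> (\<forall>i<d. (\<lambda>n. Y n i) \<longlonglongrightarrow> x i)"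
proof -
  interpret finite_product_prob_space "\<lambda>_::nat. restrict_space lborel {0..1::real}" "{..<d}"
    by (rule finite_product_prob_space_cube)
  define b where "b = (\<lambda>(n::nat) i. x i + (1 - x i) / real (Suc n))"
  define B where "B = (\<lambda>n. PiE {..<d} (\<lambda>i. {x i<..<b n i}))"
  have xi: "0 < x i" "x i < 1" if "i < d" for i using x that by (auto simp: opencube_def PiE_iff)
  have b: "x i < b n i" "b n i \<le> 1" if "i < d" for i n
  proof -
    show "x i < b n i" using xi[OF that] by (simp add: b_def)
    have "(1 - x i) / real (Suc n) \<le> (1 - x i) / 1" using xi[OF that] by (intro divide_left_mono) auto
    then show "b n i \<le> 1" by (simp add: b_def)
  qed
  have sub: "{x i<..<b n i} \<subseteq> {0<..<1}" if "i < d" for i n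
    using xi[OF that] b[OF that, of n] by auto
  have "\<exists>y\<in>B n. P y" for n
  proof (rule ccontr)
    assume neg: "\<not> (\<exists>y\<in>B n. P y)"
    have sets: "{x i<..<b n i} \<in> sets (restrict_space lborel {0..1})" if "i < d" for i
      using sub[OF that, of n] by (auto simp: sets_restrict_space intro!: image_eqI[of _ _ "{x i<..<b n i}"])
    have "B n \<in> sets (PiM {..<d} (\<lambda>_. restrict_space lborel {0..1}))"
      unfolding B_def using sets by (intro sets_PiM_I_finite) auto
    moreover have "AE y in PiM {..<d} (\<lambda>_. restrict_space lborel {0..1}). P y"
      using AE unfolding cube_measure_def AE_completion_iff .
    then have "AE y in PiM {..<d} (\<lambda>_. restrict_space lborel {0..1}). y \<notin> B n"
      by eventually_elim (use neg in auto)
    ultimately have "emeasure (PiM {..<d} (\<lambda>_. restrict_space lborel {0..1})) (B n) = 0"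
      using AE_iff_null_sets by (metis null_setsD1)
    moreover have "emeasure (PiM {..<d} (\<lambda>_. restrict_space lborel {0..1})) (B n) =
        (\<Prod>i<d. emeasure (restrict_space lborel {0..1}) {x i<..<b n i})"
      unfolding B_def using sets by (intro emeasure_PiM) auto
    moreover have "emeasure (restrict_space lborel {0..1}) {x i<..<b n i} = ennreal (b n i - x i)" if "i < d" for i
      using sub[OF that, of n] b(1)[OF that, of n] by (subst emeasure_restrict_space) auto
    ultimately have "(\<Prod>i<d. ennreal (b n i - x i)) = 0" by simp
    then show False using b(1)[of _ n] by (fastforce simp: prod_zero_iff ennreal_eq_0_iff)
  qed
  then obtain Y where Y: "\<And>n. Y n \<in> B n" "\<And>n. P (Y n)" by metis
  have "B n \<subseteq> opencube d" for n
    unfolding B_def opencube_def by (intro PiE_mono) (simp only: lessThan_iff sub)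
  then have "Y n \<in> opencube d" for n using Y(1) by blast
  moreover have "(\<lambda>n. Y n i) \<longlonglongrightarrow> x i" if "i < d" for i
  proof (rule real_tendsto_sandwich)
    show "eventually (\<lambda>n. x i \<le> Y n i) sequentially" "eventually (\<lambda>n. Y n i \<le> b n i) sequentially"
      using Y(1) that by (auto simp: B_def PiE_iff intro!: always_eventually less_imp_le)
    have "(\<lambda>n. x i + (1 - x i) * (1 / real (Suc n))) \<longlonglongrightarrow> x i + (1 - x i) * 0"
      by (intro tendsto_intros LIMSEQ_Suc[OF lim_1_over_n])
    then show "(\<lambda>n. b n i) \<longlonglongrightarrow> x i" by (simp add: b_def)
  qed auto
  ultimately show ?thesis using Y(2) by blast
qed

text \<open>
  The points at which the essential bound holds are dense, so a continuous function satisfies it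
  everywhere. In the application \<open>G\<close> is an iterated \<open>dir_deriv\<close>, which has a continuous
  expression \<open>g\<close> in the open cube.
\<close>
lemma Linf_norm_bound:
  assumes g: "continuous_on (cube d) g" and eq: "\<And>y. y \<in> opencube d \<Longrightarrow> G y = g y"
    and le: "Linf_norm d G \<le> ereal c" and x: "x \<in> opencube d"
  shows "\<bar>g x\<bar> \<le> c"
proof -
  have "AE y in cube_measure d. ereal \<bar>G y\<bar> \<le> Linf_norm d G"
    unfolding Linf_norm_def by (rule esssup_AE)
  then have "AE y in cube_measure d. \<bar>G y\<bar> \<le> c"
    by eventually_elim (use le order_trans ereal_less_eq(3) in blast)
  from AE_cube_dense[OF this x] obtain Y where
    Y: "\<And>n. Y n \<in> opencube d" "\<And>n. \<bar>G (Y n)\<bar> \<le> c" "\<And>i. i < d \<Longrightarrow> (\<lambda>n. Y n i) \<longlonglongrightarrow> x i" by blast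
  have "(\<lambda>n. \<bar>g (Y n)\<bar>) \<longlonglongrightarrow> \<bar>g x\<bar>"
    by (intro tendsto_rabs continuous_tendsto_cube[OF g]) (use x Y in \<open>auto intro: opencube_subset[THEN subsetD] always_eventually\<close>)
  then show ?thesis by (rule LIMSEQ_le_const2) (use Y eq in auto)
qed

text \<open>
  The norm bounds the derivatives in unit directions; homogeneity in \<open>v\<close> gives the rest.
  For \<open>v = 0\<close> no unit direction is available, and the form vanishes because \<open>k > 0\<close>.
\<close>
lemma dir_form_bound:
  assumes f: "smooth_on_cube d f" and norm: "F_norm d f \<le> 1" and x: "x \<in> opencube d" and k: "0 < k"
  shows "\<bar>dir_form d v k f x\<bar> \<le> (L2_set v {..<d}) ^ k"
proof (cases "L2_set v {..<d} = 0")
  case True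
  then have "dir_form d v k f x = dir_form d (\<lambda>i. 0 * v i) k f x"
    by (intro dir_form_cong) (auto simp: L2_set_eq_0_iff)
  also have "\<dots> = 0 ^ k * dir_form d v k f x" by (rule dir_form_scale)
  finally show ?thesis using k True by (simp add: zero_power)
next
  case False
  define r where "r = L2_set v {..<d}"
  have r: "r > 0" using False L2_set_nonneg[of v "{..<d}"] unfolding r_def by linarith
  define \<theta> where "\<theta> = (\<lambda>i\<in>{..<d}. inverse r * v i)"
  have "L2_set \<theta> {..<d} = L2_set (\<lambda>i. inverse r * v i) {..<d}"
    by (intro L2_set_cong) (auto simp: \<theta>_def)
  also have "\<dots> = inverse r * r" unfolding r_def using L2_set_nonneg[of v "{..<d}"]
    by (intro L2_set_right_distrib[symmetric]) simp
  finally have \<theta>: "\<theta> \<in> unit_sphere d" using r by (simp add: unit_sphere_def \<theta>_def)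
  have "Linf_norm d ((dir_deriv d \<theta> ^^ k) f) \<le> F_norm d f"
    unfolding F_norm_def by (rule SUP_upper2[of k]) (auto intro!: SUP_upper \<theta>)
  then have le: "Linf_norm d ((dir_deriv d \<theta> ^^ k) f) \<le> ereal 1" using norm by (simp add: one_ereal_def)
  have 1: "\<bar>dir_form d \<theta> k f x\<bar> \<le> 1"
    by (rule Linf_norm_bound[OF continuous_dir_form[OF f] dir_deriv_funpow[OF f] le x])
  have "dir_form d v k f x = dir_form d (\<lambda>i. r * \<theta> i) k f x"
    using r by (intro dir_form_cong) (simp add: \<theta>_def)
  then have "\<bar>dir_form d v k f x\<bar> = r ^ k * \<bar>dir_form d \<theta> k f x\<bar>"
    using r by (simp add: dir_form_scale abs_mult)
  also have "\<dots> \<le> r ^ k * 1" using r 1 by (intro mult_left_mono) auto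
  finally show ?thesis by (simp add: r_def)
qed

section \<open>Taylor expansion at the centre of the cube\<close>

text \<open>
  The homothety with ratio \<open>h\<close> about the centre of the cube.
\<close>
abbreviation dilate :: "nat \<Rightarrow> real \<Rightarrow> (nat \<Rightarrow> real) \<Rightarrow> nat \<Rightarrow> real" where
  "dilate d h x \<equiv> line d (\<lambda>_. 1 / 2) (\<lambda>i. x i - 1 / 2) h"

definition radius :: "nat \<Rightarrow> (nat \<Rightarrow> real) \<Rightarrow> real" where
  "radius d x = L2_set (\<lambda>i. x i - 1 / 2) {..<d}"

definition monom_at :: "nat list \<Rightarrow> (nat \<Rightarrow> real) \<Rightarrow> real" where
  "monom_at w x = prod_list (map (\<lambda>i. x i - 1 / 2) w)"

definition taylor_coeff :: "nat \<Rightarrow> ((nat \<Rightarrow> real) \<Rightarrow> real) \<Rightarrow> nat list \<Rightarrow> real" where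
  "taylor_coeff d f w = foldr partial_deriv w f (\<lambda>i\<in>{..<d}. 1 / 2) / fact (length w)"

definition words_le :: "nat \<Rightarrow> nat \<Rightarrow> nat list set" where
  "words_le d m = {w. set w \<subseteq> {..<d} \<and> length w \<le> m}"

lemma finite_words_le [simp]: "finite (words_le d m)"
  unfolding words_le_def by (rule finite_lists_length_le) simp

lemma sum_words_le: "(\<Sum>w\<in>words_le d m. F w) = (\<Sum>k\<le>m. \<Sum>w\<in>words d k. F w)"
proof -
  have "words_le d m = (\<Union>k\<in>{..m}. words d k)" by (auto simp: words_le_def words_def)
  then show ?thesis by (simp add: sum.UNION_disjoint words_def[unfolded set_eq_iff] Int_def)
qed

lemma abs_cube_center:
  assumes "x \<in> cube d" "i < d" shows "\<bar>x i - 1 / 2\<bar> \<le> 1 / 2"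
proof -
  have "0 \<le> x i" "x i \<le> 1" using assms by (auto simp: cube_def PiE_iff)
  then show ?thesis by (simp add: abs_if)
qed

lemma dilate_opencube:
  assumes x: "x \<in> cube d" and u: "0 \<le> u" "u < 1"
  shows "dilate d u x \<in> opencube d"
proof -
  have "1 / 2 + u * (x i - 1 / 2) \<in> {0<..<1}" if "i < d" for i
  proof -
    have "\<bar>x i - 1 / 2\<bar> \<le> 1 / 2" using x that by (rule abs_cube_center)
    then have "\<bar>u * (x i - 1 / 2)\<bar> \<le> u * (1 / 2)" using mult_left_mono[of "\<bar>x i - 1 / 2\<bar>" "1 / 2" u] u by (simp add: abs_mult)
    then have "\<bar>u * (x i - 1 / 2)\<bar> < 1 / 2" using u by simp
    then show ?thesis unfolding abs_less_iff greaterThanLessThan_iff by linarith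
  qed
  then show ?thesis by (auto simp: opencube_def)
qed

lemma dilate_1:
  assumes "x \<in> cube d" shows "dilate d 1 x = x"
  using assms by (auto simp: cube_def PiE_iff extensional_def)

lemma monom_at_dilate:
  assumes "w \<in> words d k" shows "monom_at w (dilate d u x) = u ^ k * monom_at w x"
proof -
  have "monom_at w (dilate d u x) = u ^ length w * monom_at w x" if "set w \<subseteq> {..<d}"
    using that by (induction w) (auto simp: monom_at_def)
  then show ?thesis using assms by (auto simp: words_def)
qed

lemma radius_dilate:
  assumes "0 \<le> u" shows "radius d (dilate d u x) = u * radius d x"
proof -
  have "radius d (dilate d u x) = L2_set (\<lambda>i. u * (x i - 1 / 2)) {..<d}"
    unfolding radius_def by (intro L2_set_cong) auto
  then show ?thesis using assms by (simp add: radius_def L2_set_right_distrib)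
qed

lemma radius_nonneg [simp]: "0 \<le> radius d x"
  by (simp add: radius_def)

lemma radius_cube:
  assumes "x \<in> cube d" shows "radius d x \<le> sqrt (real d) / 2"
proof -
  have "(\<Sum>i<d. (x i - 1 / 2)\<^sup>2) \<le> (\<Sum>i<d. (1 / 2)\<^sup>2)"
  proof (intro sum_mono)
    fix i assume "i \<in> {..<d}"
    then have "\<bar>x i - 1 / 2\<bar> \<le> 1 / 2" by (intro abs_cube_center[OF assms]) simp
    then show "(x i - 1 / 2)\<^sup>2 \<le> (1 / 2)\<^sup>2" by (simp only: abs_le_square_iff[symmetric] abs_divide abs_one abs_numeral)
  qed
  also have "\<dots> = real d * (1 / 2)\<^sup>2" by simp
  finally have "radius d x \<le> sqrt (real d * (1 / 2)\<^sup>2)" unfolding radius_def L2_set_def by simp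
  then show ?thesis by (simp add: real_sqrt_mult real_sqrt_divide power2_eq_square)
qed

lemma continuous_monom_at: "continuous_on A (monom_at w)"
proof (induction w)
  case (Cons i w)
  have "monom_at (i # w) = (\<lambda>x. (x i - 1 / 2) * monom_at w x)" by (auto simp: monom_at_def)
  then show ?case using Cons
    by (auto intro!: continuous_intros continuous_on_subset[OF continuous_on_product_coordinates])
qed (simp add: monom_at_def)

text \<open>
  Taylor expansion of \<open>f\<close> on the segment from the centre of the cube to \<open>x\<close>, with the Lagrange
  form of the remainder.
\<close>
lemma taylor_expansion_opencube:
  assumes f: "smooth_on_cube d f" and norm: "F_norm d f \<le> 1" and x: "x \<in> opencube d"
  shows "\<bar>f x - (\<Sum>w\<in>words_le d m. taylor_coeff d f w * monom_at w x)\<bar> \<le> radius d x ^ Suc m / fact (Suc m)"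
proof -
  define v where "v = (\<lambda>i. x i - 1 / 2)"
  define c where "c = (\<lambda>i\<in>{..<d}. 1 / 2 :: real)"
  have x': "x \<in> cube d" using x opencube_subset by blast
  have mem: "dilate d u x \<in> opencube d" if "0 \<le> u" "u \<le> 1" for u
    using that x dilate_1[OF x'] dilate_opencube[OF x'] by (cases "u = 1") auto
  have "\<exists>t>0. t < 1 \<and> f (dilate d 1 x) =
     (\<Sum>k<Suc m. dir_form d v k f (dilate d 0 x) / fact k * 1 ^ k) +
      dir_form d v (Suc m) f (dilate d t x) / fact (Suc m) * 1 ^ Suc m"
    by (rule Maclaurin[where f = "\<lambda>u. f (dilate d u x)" and diff = "\<lambda>k u. dir_form d v k f (dilate d u x)"])
      (auto simp: v_def simp del: restrict_apply intro!: has_derivative_dir_form f mem)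
  then obtain t where t: "0 < t" "t < 1" and eq: "f x =
     (\<Sum>k\<le>m. dir_form d v k f c / fact k) + dir_form d v (Suc m) f (dilate d t x) / fact (Suc m)"
    unfolding dilate_1[OF x'] by (auto simp: c_def lessThan_Suc_atMost simp del: fact_Suc)
  have "(\<Sum>w\<in>words_le d m. taylor_coeff d f w * monom_at w x) = (\<Sum>k\<le>m. dir_form d v k f c / fact k)"
    unfolding sum_words_le
  proof (rule sum.cong[OF refl])
    fix k
    show "(\<Sum>w\<in>words d k. taylor_coeff d f w * monom_at w x) = dir_form d v k f c / fact k"
      unfolding dir_form_def sum_divide_distrib
      by (rule sum.cong[OF refl]) (auto simp: words_def taylor_coeff_def monom_at_def v_def c_def)
  qed
  with eq have "\<bar>f x - (\<Sum>w\<in>words_le d m. taylor_coeff d f w * monom_at w x)\<bar> =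
      \<bar>dir_form d v (Suc m) f (dilate d t x)\<bar> / fact (Suc m)" by (simp del: fact_Suc)
  also have "\<dots> \<le> L2_set v {..<d} ^ Suc m / fact (Suc m)"
    by (intro divide_right_mono dir_form_bound[OF f norm] mem) (use t in auto)
  finally show ?thesis by (simp only: radius_def v_def)
qed

text \<open>
  At a boundary point the estimate is the limit of the estimates at the points of the
  segment that leads there from the centre.
\<close>
lemma taylor_expansion:
  assumes f: "smooth_on_cube d f" and norm: "F_norm d f \<le> 1" and x: "x \<in> cube d"
  shows "\<bar>f x - (\<Sum>w\<in>words_le d m. taylor_coeff d f w * monom_at w x)\<bar> \<le> radius d x ^ Suc m / fact (Suc m)"
proof -
  define G where "G = (\<lambda>x. \<bar>f x - (\<Sum>w\<in>words_le d m. taylor_coeff d f w * monom_at w x)\<bar>)"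
  define u where "u = (\<lambda>n. real n / real (Suc n))"
  have u: "0 \<le> u n" "u n < 1" for n by (auto simp: u_def)
  have u_lim: "u \<longlonglongrightarrow> 1" unfolding u_def by (rule LIMSEQ_n_over_Suc_n)
  have mem: "dilate d (u n) x \<in> opencube d" for n by (rule dilate_opencube[OF x u])
  have "continuous_on (cube d) G"
    unfolding G_def by (intro continuous_intros smooth_continuous[OF f] continuous_monom_at)
  then have "(\<lambda>n. G (dilate d (u n) x)) \<longlonglongrightarrow> G x"
  proof (rule continuous_tendsto_cube[OF _ x])
    show "eventually (\<lambda>n. dilate d (u n) x \<in> cube d) sequentially"
      using mem opencube_subset by (intro always_eventually) blast
    fix i assume "i < d"
    have "(\<lambda>n. 1 / 2 + u n * (x i - 1 / 2)) \<longlonglongrightarrow> 1 / 2 + 1 * (x i - 1 / 2)"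
      by (intro tendsto_intros u_lim)
    then show "(\<lambda>n. dilate d (u n) x i) \<longlonglongrightarrow> x i" using \<open>i < d\<close> by simp
  qed
  moreover have "G (dilate d (u n) x) \<le> radius d x ^ Suc m / fact (Suc m)" for n
  proof -
    have "G (dilate d (u n) x) \<le> radius d (dilate d (u n) x) ^ Suc m / fact (Suc m)"
      unfolding G_def by (rule taylor_expansion_opencube[OF f norm mem])
    also have "\<dots> \<le> radius d x ^ Suc m / fact (Suc m)"
      using u[of n] by (intro divide_right_mono power_mono)
        (auto simp: radius_dilate intro: mult_left_le_one_le)
    finally show ?thesis .
  qed
  ultimately have "G x \<le> radius d x ^ Suc m / fact (Suc m)"
    by (intro LIMSEQ_le_const2) auto
  then show ?thesis by (simp add: G_def)
qed

section \<open>Integration over the cube\<close>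

text \<open>
  The product \<open>\<sigma>\<close>-algebra over all of \<open>nat\<close> is the Borel \<open>\<sigma>\<close>-algebra of the topology in which
  \<open>g\<close> is continuous. The inclusion of the cube is measurable into it, since each coordinate is
  measurable or constant.
\<close>
lemma continuous_borel_measurable_cube:
  assumes "continuous_on (cube d) g" shows "g \<in> borel_measurable (cube_measure d)"
proof -
  let ?M = "PiM {..<d} (\<lambda>_. restrict_space lborel {0..1::real})"
  have "(\<lambda>x. x) \<in> measurable ?M (PiM UNIV (\<lambda>_. borel))"
  proof (rule measurable_PiM_single')
    fix i :: nat
    show "(\<lambda>x. x i) \<in> borel_measurable ?M"
    proof (cases "i < d")
      case True
      then have "(\<lambda>x. x i) \<in> measurable ?M (restrict_space lborel {0..1})" by (intro measurable_component_singleton) simp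
      then show ?thesis by (simp add: measurable_restrict_space2_iff)
    next
      case False
      then have "(\<lambda>x. x i) \<in> borel_measurable ?M \<longleftrightarrow> (\<lambda>x. undefined :: real) \<in> borel_measurable ?M"
        by (intro measurable_cong) (auto simp: space_PiM PiE_iff extensional_def)
      then show ?thesis by simp
    qed
  qed simp
  then have "(\<lambda>x. x) \<in> measurable ?M (restrict_space borel (cube d))"
    by (intro measurable_restrict_space2)
      (auto simp: space_PiM cube_def space_restrict_space measurable_cong_sets[OF refl sets_PiM_equal_borel])
  from measurable_compose[OF this borel_measurable_continuous_on_restrict[OF assms]]
  show ?thesis unfolding cube_measure_def by (intro measurable_completion) simp
qed

lemma integrable_cube:
  fixes g :: "(nat \<Rightarrow> real) \<Rightarrow> real"
  assumes "continuous_on (cube d) g" "\<And>x. x \<in> cube d \<Longrightarrow> \<bar>g x\<bar> \<le> B"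
  shows "integrable (cube_measure d) g"
proof -
  interpret prob_space "cube_measure d" by (rule prob_space_cube_measure)
  show ?thesis
    by (rule integrable_const_bound[where B = B]) (use assms in \<open>auto intro!: AE_I2 continuous_borel_measurable_cube\<close>)
qed

lemma integral_cube_bound:
  assumes g: "continuous_on (cube d) g" and B: "\<And>x. x \<in> cube d \<Longrightarrow> \<bar>g x\<bar> \<le> B"
  shows "\<bar>Int_cube d g\<bar> \<le> B"
proof -
  interpret prob_space "cube_measure d" by (rule prob_space_cube_measure)
  have i: "integrable (cube_measure d) g" by (rule integrable_cube[OF g B])
  have "\<bar>Int_cube d g\<bar> \<le> (LINT x|cube_measure d. \<bar>g x\<bar>)"
    unfolding Int_cube_def by (rule integral_abs_bound)
  also have "\<dots> \<le> (LINT x|cube_measure d. B)"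
    by (rule integral_mono) (use i B in auto)
  also have "\<dots> = B" by (simp add: prob_space[unfolded space_cube_measure])
  finally show ?thesis .
qed

lemma integrable_monom_at: "integrable (cube_measure d) (monom_at w)" if "set w \<subseteq> {..<d}"
proof (rule integrable_cube)
  fix x assume x: "x \<in> cube d"
  show "\<bar>monom_at w x\<bar> \<le> 1" using that
  proof (induction w)
    case (Cons i w)
    have "\<bar>x i - 1 / 2\<bar> \<le> 1" using abs_cube_center[OF x, of i] Cons.prems by simp
    then have "\<bar>x i - 1 / 2\<bar> * \<bar>monom_at w x\<bar> \<le> 1 * 1" using Cons by (intro mult_mono) auto
    then show ?case by (simp add: monom_at_def abs_mult)
  qed (simp add: monom_at_def)
qed (rule continuous_monom_at)

section \<open>Cubature rules that are exact on polynomials\<close>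

text \<open>
  Along \<open>dilate d h x\<close> the polynomial becomes a polynomial in \<open>h\<close>, with the values at
  \<open>x\<close> of the homogeneous components as coefficients. It has infinitely many zeros.
\<close>
lemma homogeneous_component_vanishes:
  assumes zero: "\<And>x. x \<in> cube d \<Longrightarrow> (\<Sum>w\<in>words_le d m. c w * monom_at w x) = 0"
    and k: "k \<le> m" and x: "x \<in> cube d"
  shows "(\<Sum>w\<in>words d k. c w * monom_at w x) = 0"
proof -
  define q where "q = (\<lambda>j. \<Sum>w\<in>words d j. c w * monom_at w x)"
  have "(\<Sum>j\<le>m. q j * h ^ j) = 0" if h: "h \<in> {0<..<1}" for h
  proof -
    have "(\<Sum>w\<in>words_le d m. c w * monom_at w (dilate d h x)) = (\<Sum>j\<le>m. q j * h ^ j)"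
      unfolding sum_words_le q_def
      by (intro sum.cong refl) (simp add: monom_at_dilate sum_distrib_left mult_ac)
    moreover have "dilate d h x \<in> cube d"
      using h by (intro subsetD[OF opencube_subset] dilate_opencube[OF x]) auto
    ultimately show ?thesis using zero by metis
  qed
  then have "{0<..<1} \<subseteq> {h. (\<Sum>j\<le>m. q j * h ^ j) = 0}" by auto
  moreover have "infinite {0<..<1::real}" by (rule infinite_Ioo) simp
  ultimately have "infinite {h. (\<Sum>j\<le>m. q j * h ^ j) = 0}" by (metis finite_subset)
  then have "q k = 0" using k polyfun_finite_roots by blast
  then show ?thesis by (simp add: q_def)
qed

text \<open>
  The functional that integrates the homogeneous component of degree \<open>k\<close> is well defined on
  polynomials of degree at most \<open>m\<close>, hence a combination of point evaluations. Treating each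
  degree separately is what permits the rescaling of the points below.
\<close>
lemma homogeneous_cubature:
  assumes k: "k \<le> m"
  shows "\<exists>P a. finite P \<and> P \<subseteq> cube d \<and> card P \<le> card (words_le d m) \<and>
    (\<forall>w\<in>words_le d m. (\<Sum>x\<in>P. a x * monom_at w x) = (if length w = k then Int_cube d (monom_at w) else 0))"
proof (rule functional_as_evaluations)
  fix c assume zero: "\<And>x. x \<in> cube d \<Longrightarrow> (\<Sum>w\<in>words_le d m. c w * monom_at w x) = 0"
  have len: "length w = j" if "w \<in> words d j" for w j using that by (simp add: words_def)
  have "(\<Sum>w\<in>words_le d m. c w * (if length w = k then Int_cube d (monom_at w) else 0)) =
      (\<Sum>j\<le>m. if j = k then \<Sum>w\<in>words d k. c w * Int_cube d (monom_at w) else 0)"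
    unfolding sum_words_le by (intro sum.cong refl) (auto simp: len)
  also have "\<dots> = (\<Sum>w\<in>words d k. c w * Int_cube d (monom_at w))" using k by simp
  also have "\<dots> = (LINT x|cube_measure d. (\<Sum>w\<in>words d k. c w * monom_at w x))"
    unfolding Int_cube_def
    by (subst Bochner_Integration.integral_sum) (auto simp: words_def intro!: integrable_monom_at)
  also have "\<dots> = (LINT x|cube_measure d. 0)"
    by (intro Bochner_Integration.integral_cong refl)
      (simp add: homogeneous_component_vanishes[OF zero k])
  finally show "(\<Sum>w\<in>words_le d m. c w * (if length w = k then Int_cube d (monom_at w) else 0)) = 0"
    by simp
qed simp

lemma linear_algorithms_finite_sum:
  assumes J: "finite J" "card J \<le> n" and p: "\<And>j. j \<in> J \<Longrightarrow> p j \<in> cube d"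
  shows "(\<lambda>f. \<Sum>j\<in>J. a j * f (p j)) \<in> linear_algorithms n d"
proof -
  obtain b where b: "bij_betw b {0..<card J} J"
    using ex_bij_betw_nat_finite[OF J(1)] by blast
  have "(\<lambda>f. \<Sum>j\<in>J. a j * f (p j)) = (\<lambda>f. \<Sum>i<card J. a (b i) * f (p (b i)))"
    by (rule ext) (simp add: sum.reindex_bij_betw[OF b, symmetric] lessThan_atLeast0)
  moreover have "\<forall>i<card J. p (b i) \<in> cube d" using b p by (auto dest: bij_betwE)
  ultimately show ?thesis using J(2) unfolding linear_algorithms_def
    by (intro CollectI exI[of _ "card J"] conjI exI[of _ "\<lambda>i. a (b i)"] exI[of _ "\<lambda>i. p (b i)"])
qed

text \<open>
  Rescale the cubature rule for degree \<open>k\<close>: sample at \<open>dilate d h x\<close> instead of \<open>x\<close> and divide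
  the weight by \<open>h ^ k\<close>. This does not change the result on the component of degree \<open>k\<close>, and the
  other components still contribute 0. The sum over \<open>k \<le> m\<close> is a rule that is
  exact on polynomials of degree at most \<open>m\<close>. Its weights grow at most like \<open>h ^ (- m)\<close>, but the
  Taylor remainder at its points decays like \<open>h ^ Suc m\<close>, so the rule applied to the remainder
  is at most \<open>h * K\<close>. Only the integral of the remainder survives as \<open>h\<close> tends to 0.
\<close>
lemma min_error_le_taylor_remainder:
  assumes n: "Suc m * card (words_le d m) \<le> n"
  shows "min_error n d \<le> ereal ((sqrt (real d) / 2) ^ Suc m / fact (Suc m))"
proof -
  define W where "W = words_le d m"
  define \<rho> where "\<rho> = sqrt (real d) / 2"
  define E where "E = \<rho> ^ Suc m / fact (Suc m)"
  have \<rho>: "0 \<le> \<rho>" by (simp add: \<rho>_def)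
  have E: "0 \<le> E" unfolding E_def using \<rho> by (intro divide_nonneg_nonneg) auto
  define exact where "exact = (\<lambda>k P a. finite P \<and> P \<subseteq> cube d \<and> card P \<le> card W \<and>
    (\<forall>w\<in>W. (\<Sum>x\<in>P. a x * monom_at w x) = (if length w = k then Int_cube d (monom_at w) else 0)))"
  have "\<forall>k\<in>{..m}. \<exists>P a. exact k P a"
    unfolding exact_def W_def by (intro ballI homogeneous_cubature) simp
  then obtain P a where Pa: "\<And>k. k \<le> m \<Longrightarrow> exact k (P k) (a k)"
    by (metis atMost_iff)
  have P: "finite (P k)" "P k \<subseteq> cube d" "card (P k) \<le> card W" if "k \<le> m" for k
    using Pa[OF that] by (auto simp only: exact_def)
  have a: "(\<Sum>x\<in>P k. a k x * monom_at w x) = (if length w = k then Int_cube d (monom_at w) else 0)"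
    if "k \<le> m" "w \<in> W" for k w
    using Pa[OF that(1)] that(2) unfolding exact_def by blast
  define K where "K = (\<Sum>k\<le>m. \<Sum>x\<in>P k. \<bar>a k x\<bar> * E)"
  define A where "A = (\<lambda>h f. \<Sum>(k, x)\<in>Sigma {..m} P. a k x / h ^ k * f (dilate d h x))"
  have A_sum: "A h f = (\<Sum>k\<le>m. \<Sum>x\<in>P k. a k x / h ^ k * f (dilate d h x))" for h f
    unfolding A_def using P(1) by (subst sum.Sigma) auto
  have card_Sigma: "card (Sigma {..m} P) \<le> n"
  proof -
    have "card (Sigma {..m} P) = (\<Sum>k\<le>m. card (P k))" using P(1) by (intro card_SigmaI) auto
    also have "\<dots> \<le> (\<Sum>k\<le>m. card W)" using P(3) by (intro sum_mono) auto
    finally show ?thesis using n by (simp add: W_def)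
  qed
  \<comment> \<open>The constant \<open>K\<close> depends on the weights and so on \<open>d\<close> and \<open>m\<close>, but not on \<open>h\<close> or \<open>f\<close>.\<close>
  have bound: "min_error n d \<le> ereal (E + h * K)" if h: "0 < h" "h < 1" for h
  proof -
    have dil: "dilate d h x \<in> cube d" if "x \<in> cube d" for x
      using h by (intro subsetD[OF opencube_subset] dilate_opencube[OF that]) auto
    have "A h \<in> linear_algorithms n d"
      using linear_algorithms_finite_sum[of "Sigma {..m} P" n "\<lambda>(k, x). dilate d h x" d "\<lambda>(k, x). a k x / h ^ k"]
        P(1,2) card_Sigma dil
      by (force simp: A_def case_prod_unfold)
    then have "min_error n d \<le> worst_case_error d (A h)"
      unfolding min_error_def by (rule INF_lower)
    also have "\<dots> \<le> ereal (E + h * K)"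
      unfolding worst_case_error_def
    proof (rule SUP_least)
      fix f assume "f \<in> {f \<in> F_space d. F_norm d f \<le> 1}"
      then have f: "smooth_on_cube d f" and norm: "F_norm d f \<le> 1" by (auto simp: F_space_def)
      define c where "c = taylor_coeff d f"
      define T where "T = (\<lambda>x. \<Sum>w\<in>W. c w * monom_at w x)"
      define R where "R = (\<lambda>x. f x - T x)"
      have fTR: "f x = T x + R x" for x by (simp add: R_def)
      have R_radius: "\<bar>R x\<bar> \<le> radius d x ^ Suc m / fact (Suc m)" if "x \<in> cube d" for x
        using taylor_expansion[OF f norm that] by (simp add: R_def T_def c_def W_def)
      have R_E: "\<bar>R x\<bar> \<le> E" if "x \<in> cube d" for x
      proof -
        have "radius d x ^ Suc m / fact (Suc m) \<le> E" unfolding E_def \<rho>_def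
          by (intro divide_right_mono power_mono radius_cube that) auto
        with R_radius[OF that] show ?thesis by linarith
      qed
      have contR: "continuous_on (cube d) R"
        unfolding R_def T_def by (intro continuous_intros smooth_continuous[OF f] continuous_monom_at)
      have intR: "integrable (cube_measure d) R" by (rule integrable_cube[OF contR R_E])
      have intM: "integrable (cube_measure d) (\<lambda>x. c w * monom_at w x)" if "w \<in> W" for w
        using that by (intro integrable_mult_right integrable_monom_at) (auto simp: W_def words_le_def)
      have intT: "integrable (cube_measure d) T"
        unfolding T_def using intM by (intro Bochner_Integration.integrable_sum) auto
      have Int_f: "Int_cube d f = (\<Sum>w\<in>W. c w * Int_cube d (monom_at w)) + Int_cube d R"
      proof -
        have "Int_cube d f = Int_cube d T + Int_cube d R"
          unfolding Int_cube_def fTR using intT intR by (rule Bochner_Integration.integral_add)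
        moreover have "Int_cube d T = (\<Sum>w\<in>W. c w * Int_cube d (monom_at w))"
          unfolding Int_cube_def T_def using intM
          by (subst Bochner_Integration.integral_sum) auto
        ultimately show ?thesis by simp
      qed
      have A_T: "A h T = (\<Sum>w\<in>W. c w * Int_cube d (monom_at w))"
      proof -
        have "(\<Sum>x\<in>P k. a k x / h ^ k * T (dilate d h x)) =
            (\<Sum>w\<in>W. if length w = k then c w * Int_cube d (monom_at w) else 0)" if k: "k \<le> m" for k
        proof -
          have "(\<Sum>x\<in>P k. a k x / h ^ k * T (dilate d h x)) =
              (\<Sum>x\<in>P k. \<Sum>w\<in>W. c w * h ^ length w / h ^ k * (a k x * monom_at w x))"
            unfolding T_def sum_distrib_left
          proof (intro sum.cong refl)
            fix x w assume "w \<in> W"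
            then have "w \<in> words d (length w)" by (simp add: W_def words_le_def words_def)
            from monom_at_dilate[OF this, of h x]
            show "a k x / h ^ k * (c w * monom_at w (dilate d h x)) =
              c w * h ^ length w / h ^ k * (a k x * monom_at w x)" by (simp only:) (simp add: mult_ac)
          qed
          also have "\<dots> = (\<Sum>w\<in>W. c w * h ^ length w / h ^ k * (\<Sum>x\<in>P k. a k x * monom_at w x))"
            unfolding sum_distrib_left by (rule sum.swap)
          also have "\<dots> = (\<Sum>w\<in>W. if length w = k then c w * Int_cube d (monom_at w) else 0)"
            using h by (intro sum.cong refl) (simp add: a[OF k])
          finally show ?thesis .
        qed
        then have "A h T = (\<Sum>k\<le>m. \<Sum>w\<in>W. if length w = k then c w * Int_cube d (monom_at w) else 0)"
          unfolding A_sum by (intro sum.cong) auto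
        also have "\<dots> = (\<Sum>w\<in>W. \<Sum>k\<le>m. if length w = k then c w * Int_cube d (monom_at w) else 0)"
          by (rule sum.swap)
        also have "\<dots> = (\<Sum>w\<in>W. c w * Int_cube d (monom_at w))"
          by (intro sum.cong refl) (auto simp: W_def words_le_def)
        finally show ?thesis .
      qed
      have A_R: "\<bar>A h R\<bar> \<le> h * K"
      proof -
        have "\<bar>A h R\<bar> \<le> (\<Sum>k\<le>m. \<Sum>x\<in>P k. \<bar>a k x / h ^ k * R (dilate d h x)\<bar>)"
          unfolding A_sum by (intro order_trans[OF sum_abs] sum_mono order_refl)
        also have "\<dots> \<le> (\<Sum>k\<le>m. \<Sum>x\<in>P k. h * (\<bar>a k x\<bar> * E))"
        proof (intro sum_mono)
          fix k x assume k: "k \<in> {..m}" and x: "x \<in> P k"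
          then have xc: "x \<in> cube d" using P(2) by auto
          have "\<bar>R (dilate d h x)\<bar> \<le> radius d (dilate d h x) ^ Suc m / fact (Suc m)"
            by (rule R_radius[OF dil[OF xc]])
          also have "\<dots> = (h * radius d x) ^ Suc m / fact (Suc m)"
            using h by (subst radius_dilate) auto
          also have "\<dots> \<le> (h * \<rho>) ^ Suc m / fact (Suc m)" unfolding \<rho>_def
            using h by (intro divide_right_mono power_mono mult_left_mono radius_cube xc) auto
          also have "\<dots> = h ^ Suc m * E" by (simp add: E_def power_mult_distrib)
          finally have "\<bar>a k x / h ^ k * R (dilate d h x)\<bar> \<le> \<bar>a k x\<bar> / h ^ k * (h ^ Suc m * E)"
            using h unfolding abs_mult by (simp add: abs_divide divide_right_mono mult_left_mono)
          also have "h ^ Suc m = h ^ k * h ^ (Suc m - k)"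
            using k by (simp add: power_add[symmetric])
          also have "\<bar>a k x\<bar> / h ^ k * (h ^ k * h ^ (Suc m - k) * E) = h ^ (Suc m - k) * (\<bar>a k x\<bar> * E)"
            using h by simp
          also have "\<dots> \<le> h ^ 1 * (\<bar>a k x\<bar> * E)"
            using h k E by (intro mult_right_mono power_decreasing) auto
          finally show "\<bar>a k x / h ^ k * R (dilate d h x)\<bar> \<le> h * (\<bar>a k x\<bar> * E)"
            unfolding power_one_right .
        qed
        also have "\<dots> = h * K" by (simp add: K_def sum_distrib_left)
        finally show ?thesis .
      qed
      have "A h f = A h T + A h R"
        unfolding A_sum fTR by (simp add: distrib_left sum.distrib)
      then have "Int_cube d f - A h f = Int_cube d R - A h R" using Int_f A_T by simp
      moreover have "\<bar>Int_cube d R\<bar> \<le> E" by (rule integral_cube_bound[OF contR R_E])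
      ultimately show "ereal \<bar>Int_cube d f - A h f\<bar> \<le> ereal (E + h * K)" using A_R by simp
    qed
    finally show ?thesis .
  qed
  have "(\<lambda>n. E + 1 / real (Suc (Suc n)) * K) \<longlonglongrightarrow> E + 0 * K"
    by (intro tendsto_intros LIMSEQ_Suc LIMSEQ_Suc[OF lim_1_over_n])
  then have "(\<lambda>n. ereal (E + 1 / real (Suc (Suc n)) * K)) \<longlonglongrightarrow> ereal E" by simp
  then have "min_error n d \<le> ereal E"
    by (rule LIMSEQ_le_const) (intro exI[of _ 0] allI impI bound; simp)
  then show ?thesis by (simp add: E_def \<rho>_def)
qed

section \<open>The information complexity\<close>

lemma card_words_le_bound:
  assumes "1 \<le> d" shows "card (words_le d m) \<le> Suc m * d ^ m"
proof -
  have "card (words_le d m) = (\<Sum>i\<le>m. d ^ i)"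
    unfolding words_le_def using card_lists_length_le[of "{..<d}" m] by simp
  also have "\<dots> \<le> (\<Sum>i\<le>m. d ^ m)" using assms by (intro sum_mono power_increasing) auto
  finally show ?thesis by simp
qed

text \<open>
  A single term of the exponential series; it replaces Stirling's formula.
\<close>
lemma power_div_fact_le_exp:
  fixes x :: real
  assumes "0 \<le> x" shows "x ^ n / fact n \<le> exp x"
proof -
  have "sum (\<lambda>k. x ^ k /\<^sub>R fact k) {n} \<le> (\<Sum>k. x ^ k /\<^sub>R fact k)"
    using assms by (intro sum_le_suminf summable_exp_generic) auto
  then show ?thesis by (simp add: exp_def divide_inverse mult.commute)
qed

text \<open>
  A degree above \<open>exp 1 * sqrt d / 2 + ln (1 / \<epsilon>)\<close> brings the remainder below \<open>\<epsilon>\<close>; the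
  factor 2 of \<open>sqrt d\<close> is a convenient bound for \<open>exp 1 / 2\<close>.
\<close>
definition taylor_degree :: "real \<Rightarrow> nat \<Rightarrow> nat" where
  "taylor_degree \<epsilon> d = nat \<lceil>2 * sqrt (real d) + ln (inverse \<epsilon>)\<rceil>"

text \<open>
  With \<open>y = sqrt d / 2\<close> and \<open>M\<close> the order of the remainder,
  \<open>y ^ M / fact M = exp (- M) * (exp 1 * y) ^ M / fact M \<le> exp (exp 1 * y - M)\<close>.
\<close>
lemma taylor_remainder_le:
  assumes \<epsilon>: "0 < \<epsilon>" "\<epsilon> < 1"
  shows "(sqrt (real d) / 2) ^ Suc (taylor_degree \<epsilon> d) / fact (Suc (taylor_degree \<epsilon> d)) \<le> \<epsilon>"
proof -
  define M where "M = Suc (taylor_degree \<epsilon> d)"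
  define y where "y = sqrt (real d) / 2"
  have y: "0 \<le> y" by (simp add: y_def)
  have M: "2 * sqrt (real d) + ln (inverse \<epsilon>) \<le> real M"
    unfolding M_def taylor_degree_def by linarith
  have "exp 1 * y \<le> 3 * y" using exp_le y by (intro mult_right_mono)
  also have "\<dots> \<le> 2 * sqrt (real d)" by (simp add: y_def)
  finally have eM: "exp 1 * y - real M \<le> ln \<epsilon>" using M \<epsilon> by (simp add: ln_inverse)
  have "exp (real M) * (y ^ M / fact M) = (exp 1 * y) ^ M / fact M"
    by (simp add: power_mult_distrib exp_of_nat_mult[symmetric])
  also have "\<dots> \<le> exp (exp 1 * y)" using y by (intro power_div_fact_le_exp) simp
  finally have "y ^ M / fact M \<le> exp (exp 1 * y) / exp (real M)"
    by (subst pos_le_divide_eq) (auto simp: mult.commute)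
  also have "\<dots> = exp (exp 1 * y - real M)" by (simp add: exp_diff)
  also have "\<dots> \<le> exp (ln \<epsilon>)" using eM by simp
  also have "\<dots> = \<epsilon>" using \<epsilon> by simp
  finally show ?thesis by (simp only: M_def y_def)
qed

lemma min_error_le:
  assumes \<epsilon>: "0 < \<epsilon>" "\<epsilon> < 1" and d: "1 \<le> d"
  shows "min_error (Suc (taylor_degree \<epsilon> d) ^ 2 * d ^ taylor_degree \<epsilon> d) d \<le> ereal \<epsilon>"
proof -
  define m where "m = taylor_degree \<epsilon> d"
  have "Suc m * card (words_le d m) \<le> Suc m * (Suc m * d ^ m)"
    by (intro mult_left_mono card_words_le_bound d) simp
  then have "min_error (Suc m ^ 2 * d ^ m) d \<le> ereal ((sqrt (real d) / 2) ^ Suc m / fact (Suc m))"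
    by (intro min_error_le_taylor_remainder) (simp only: power2_eq_square mult.assoc)
  also have "\<dots> \<le> ereal \<epsilon>" unfolding m_def using taylor_remainder_le[OF \<epsilon>] by (simp only: ereal_less_eq(3))
  finally show ?thesis by (simp only: m_def)
qed

text \<open>
  With \<open>m\<close> the Taylor degree, the number of points used has logarithm
  \<open>2 * ln (m + 1) + m * ln d \<le> (2 + ln d) * m\<close>. Complexity 0 is a separate case, because
  the logarithm is monotone on positive arguments only.
\<close>
lemma ln_info_complexity_le:
  assumes \<epsilon>: "0 < \<epsilon>" "\<epsilon> < 1" and d: "1 \<le> d"
  shows "ln (real (info_complexity \<epsilon> d)) \<le>
    (2 + ln (real d)) * (2 * sqrt (real d) + ln (inverse \<epsilon>) + 1)"
proof -
  define m where "m = taylor_degree \<epsilon> d"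
  define X where "X = 2 * sqrt (real d) + ln (inverse \<epsilon>) + 1"
  have ln\<epsilon>: "0 \<le> ln (inverse \<epsilon>)" using \<epsilon> by (simp add: ln_inverse)
  then have X: "0 \<le> X" by (simp add: X_def)
  have m: "real m \<le> X" unfolding m_def X_def taylor_degree_def
    using ln\<epsilon> real_sqrt_ge_zero[of "real d"] by linarith
  have ln_d: "0 \<le> ln (real d)" using d by simp
  show ?thesis
  proof (cases "info_complexity \<epsilon> d = 0")
    case True
    then show ?thesis using X ln_d by (simp add: X_def)
  next
    case False
    have "info_complexity \<epsilon> d \<le> Suc m ^ 2 * d ^ m"
      unfolding info_complexity_def m_def by (rule Least_le) (rule min_error_le[OF \<epsilon> d])
    then have "ln (real (info_complexity \<epsilon> d)) \<le> ln (real (Suc m ^ 2 * d ^ m))"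
      using False by (subst ln_le_cancel_iff) (use d in \<open>auto simp del: of_nat_mult of_nat_power\<close>)
    also have "\<dots> = 2 * ln (real (Suc m)) + real m * ln (real d)"
      using d by (simp add: ln_mult ln_realpow del: of_nat_Suc)
    also have "ln (real (Suc m)) \<le> real m" using ln_add_one_self_le_self[of "real m"] by (simp add: add.commute)
    also have "2 * real m + real m * ln (real d) = (2 + ln (real d)) * real m" by (simp add: algebra_simps)
    also have "\<dots> \<le> (2 + ln (real d)) * X" using ln_d m by (intro mult_left_mono) auto
    finally show ?thesis by (simp add: X_def)
  qed
qed

section \<open>Weak tractability\<close>

text \<open>
  The dominant terms are \<open>sqrt D * ln D\<close>, which needs an exponent above \<open>1 / 2\<close>, and
  \<open>ln D * ln x\<close>, which the inequality between geometric and arithmetic mean separates into a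
  function of \<open>x\<close> and a function of \<open>D\<close>.
\<close>
lemma complexity_bound_le_powr:
  assumes a: "0 < a" and p: "1 / 2 < p"
  obtains C where "0 \<le> C" and "\<And>x D::real. 1 \<le> x \<Longrightarrow> 1 \<le> D \<Longrightarrow>
    (2 + ln D) * (2 * sqrt D + ln x + 1) \<le> C * (x powr a + D powr p)"
proof
  define C where "C = 6 + 2 / a + 2 / (p - 1 / 2) + 1 / p + 2 / a\<^sup>2 + 2 / p\<^sup>2"
  show "0 \<le> C" using a p by (simp add: C_def)
  fix x D :: real assume x: "1 \<le> x" and D: "1 \<le> D"
  have p0: "0 < p" using p by simp
  define u where "u = x powr a"
  define v where "v = D powr p"
  have u: "0 \<le> u" and v: "1 \<le> v" using D p0 by (auto simp: u_def v_def ge_one_powr_ge_zero)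
  have lnx: "0 \<le> ln x" and lnD: "0 \<le> ln D" using x D by auto
  have sqrt: "sqrt D \<le> v" unfolding v_def using D p by (simp add: powr_half_sqrt[symmetric] powr_mono)
  have lnx_u: "ln x \<le> u / a" unfolding u_def by (rule ln_powr_bound[OF x a])
  have lnD_v: "ln D \<le> v / p" unfolding v_def by (rule ln_powr_bound[OF D p0])
  have sq: "(ln z)\<^sup>2 \<le> 4 * (z powr b) / b\<^sup>2" if "1 \<le> z" "0 < b" for z b :: real
  proof -
    have "ln z \<le> z powr (b / 2) / (b / 2)" using that by (intro ln_powr_bound) auto
    then have "(ln z)\<^sup>2 \<le> (z powr (b / 2) / (b / 2))\<^sup>2" using that by (intro power_mono) auto
    also have "\<dots> = 4 * (z powr (b / 2))\<^sup>2 / b\<^sup>2" by (simp add: power_divide)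
    also have "(z powr (b / 2))\<^sup>2 = z powr b" using that by (simp add: power2_eq_square powr_add[symmetric])
    finally show ?thesis .
  qed
  have prod: "ln D * ln x \<le> 2 * u / a\<^sup>2 + 2 * v / p\<^sup>2"
  proof -
    have "2 * (ln D * ln x) \<le> (ln D)\<^sup>2 + (ln x)\<^sup>2" using sum_squares_bound[of "ln D" "ln x"] by (simp add: mult.assoc)
    then show ?thesis using sq[OF x a] sq[OF D p0] by (simp add: u_def v_def)
  qed
  have sqrt_ln: "sqrt D * ln D \<le> v / (p - 1 / 2)"
  proof -
    have "sqrt D * ln D \<le> D powr (1 / 2) * (D powr (p - 1 / 2) / (p - 1 / 2))"
      using D p by (intro mult_mono ln_powr_bound) (auto simp: powr_half_sqrt)
    also have "\<dots> = v / (p - 1 / 2)" by (simp add: v_def powr_add[symmetric])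
    finally show ?thesis .
  qed
  have "(2 + ln D) * (2 * sqrt D + ln x + 1) =
      4 * sqrt D + 2 * ln x + 2 + 2 * (sqrt D * ln D) + ln D * ln x + ln D"
    by (simp add: algebra_simps)
  also have "\<dots> \<le> 4 * v + 2 * (u / a) + 2 * v + 2 * (v / (p - 1 / 2)) + (2 * u / a\<^sup>2 + 2 * v / p\<^sup>2) + v / p"
    using sqrt lnx_u v sqrt_ln prod lnD_v by (intro add_mono mult_left_mono) auto
  also have "\<dots> = (2 / a + 2 / a\<^sup>2) * u + (6 + 2 / (p - 1 / 2) + 2 / p\<^sup>2 + 1 / p) * v"
    by (simp add: algebra_simps)
  also have "\<dots> \<le> C * u + C * v"
    using u v a p by (intro add_mono mult_right_mono) (auto simp: C_def)
  finally show "(2 + ln D) * (2 * sqrt D + ln x + 1) \<le> C * (x powr a + D powr p)"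
    by (simp add: u_def v_def algebra_simps)
qed

text \<open>
  The larger of \<open>x k\<close> and \<open>D k\<close> is at least half of their sum.
\<close>
lemma filterlim_powr_sum_at_top:
  fixes x D :: "nat \<Rightarrow> real"
  assumes s: "0 < s" and t: "0 < t" and x: "\<And>k. 1 \<le> x k" and D: "\<And>k. 1 \<le> D k"
    and lim: "filterlim (\<lambda>k. x k + D k) at_top sequentially"
  shows "filterlim (\<lambda>k. x k powr s + D k powr t) at_top sequentially"
proof -
  define q where "q = min s t"
  have q: "0 < q" "q \<le> s" "q \<le> t" using s t by (auto simp: q_def)
  have "filterlim (\<lambda>k. ((x k + D k) * (1 / 2)) powr q) at_top sequentially"
    by (rule filterlim_compose[OF real_powr_at_top[OF q(1)]])
      (intro filterlim_at_top_mult_tendsto_pos[OF tendsto_const _ lim], simp)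
  then show ?thesis
  proof (rule filterlim_at_top_mono, intro always_eventually allI)
    fix k
    define M where "M = (x k + D k) * (1 / 2)"
    have M: "1 \<le> M" using x[of k] D[of k] by (simp add: M_def)
    have "M powr q \<le> x k powr s \<or> M powr q \<le> D k powr t"
    proof (cases "M \<le> x k")
      case True
      then show ?thesis using M q by (intro disjI1 powr_mono_both) auto
    next
      case False
      then have "M \<le> D k" by (simp add: M_def)
      then show ?thesis using M q by (intro disjI2 powr_mono_both) auto
    qed
    then show "M powr q \<le> x k powr s + D k powr t"
      by (smt (verit) powr_ge_zero)
  qed
qed

theorem theorem4p9:
  fixes s t :: real
  assumes "s > 0" and "t > 1 / 2"
  shows "weakly_tractable s t"
  unfolding weakly_tractable_def
proof (intro conjI allI impI)
  fix \<epsilon> :: real and d :: nat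
  assume "0 < \<epsilon> \<and> \<epsilon> < 1 \<and> 1 \<le> d"
  then show "\<exists>n. min_error n d \<le> ereal \<epsilon>" using min_error_le by blast
next
  fix \<epsilon> :: "nat \<Rightarrow> real" and d :: "nat \<Rightarrow> nat"
  assume range: "\<forall>k. 0 < \<epsilon> k \<and> \<epsilon> k < 1 \<and> 1 \<le> d k"
    and lim: "filterlim (\<lambda>k. inverse (\<epsilon> k) + real (d k)) at_top sequentially"
  define x where "x = (\<lambda>k. inverse (\<epsilon> k))"
  define D where "D = (\<lambda>k. real (d k))"
  define z where "z = (\<lambda>k. x k powr s + D k powr t)"
  \<comment> \<open>Any exponent strictly between \<open>1 / 2\<close> and \<open>t\<close> serves.\<close>
  define p where "p = (t + 1 / 2) / 2"
  have t: "0 < t" and p: "1 / 2 < p" "p < t" using assms(2) by (auto simp: p_def)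
  have x: "1 \<le> x k" and D: "1 \<le> D k" for k
    using range by (auto simp: x_def D_def one_le_inverse_iff less_imp_le)
  have z_lim: "filterlim z at_top sequentially"
    unfolding z_def using filterlim_powr_sum_at_top[OF assms(1) t x D] lim by (simp add: x_def D_def)
  obtain C where C: "0 \<le> C" and C_bound: "\<And>x D::real. 1 \<le> x \<Longrightarrow> 1 \<le> D \<Longrightarrow>
    (2 + ln D) * (2 * sqrt D + ln x + 1) \<le> C * (x powr (s / 2) + D powr p)"
    using complexity_bound_le_powr[of "s / 2" p] assms(1) p(1) by (metis half_gt_zero)
  define r where "r = (\<lambda>k. ln (real (info_complexity (\<epsilon> k) (d k))) / z k)"
  have z0: "0 < z k" for k using x[of k] D[of k] by (simp add: z_def add_pos_pos)
  have r_nonneg: "0 \<le> r k" for k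
    unfolding r_def using z0[of k] by (cases "info_complexity (\<epsilon> k) (d k)") auto
  \<comment> \<open>Both powers in the bound on the complexity are powers of \<open>z k\<close> with exponents below 1.\<close>
  have r_le: "r k \<le> C * (z k powr (- 1 / 2) + z k powr (p / t - 1))" for k
  proof -
    have "ln (real (info_complexity (\<epsilon> k) (d k))) \<le> (2 + ln (D k)) * (2 * sqrt (D k) + ln (x k) + 1)"
      using range ln_info_complexity_le by (simp add: D_def x_def)
    also have "\<dots> \<le> C * (x k powr (s / 2) + D k powr p)" by (rule C_bound[OF x D])
    also have "\<dots> \<le> C * (z k powr (1 / 2) + z k powr (p / t))"
    proof (intro mult_left_mono add_mono C)
      have "x k powr (s / 2) = (x k powr s) powr (1 / 2)" by (simp add: powr_powr)
      also have "\<dots> \<le> z k powr (1 / 2)" by (intro powr_mono2) (auto simp: z_def)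
      finally show "x k powr (s / 2) \<le> z k powr (1 / 2)" .
      have "D k powr p = (D k powr t) powr (p / t)" using t by (simp add: powr_powr)
      also have "\<dots> \<le> z k powr (p / t)" using t p by (intro powr_mono2) (auto simp: z_def)
      finally show "D k powr p \<le> z k powr (p / t)" .
    qed
    finally have "r k \<le> C * (z k powr (1 / 2) + z k powr (p / t)) / z k"
      unfolding r_def using z0[of k] by (intro divide_right_mono) auto
    also have "\<dots> = C * (z k powr (1 / 2) / z k powr 1 + z k powr (p / t) / z k powr 1)"
      using z0[of k] by (simp add: add_divide_distrib distrib_left)
    also have "\<dots> = C * (z k powr (- 1 / 2) + z k powr (p / t - 1))"
      by (simp only: powr_diff[symmetric]) simp
    finally show ?thesis .
  qed
  have "p / t - 1 < 0" using p t by (simp add: field_simps)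
  then have "(\<lambda>k. C * (z k powr (- 1 / 2) + z k powr (p / t - 1))) \<longlonglongrightarrow> C * (0 + 0)"
    by (intro tendsto_intros tendsto_neg_powr z_lim) auto
  then have "r \<longlonglongrightarrow> 0"
    by (intro tendsto_sandwich[of "\<lambda>_. 0" r sequentially "\<lambda>k. C * (z k powr (- 1 / 2) + z k powr (p / t - 1))"])
      (use r_nonneg r_le in auto)
  moreover have "\<epsilon> k powr (- s) = x k powr s" for k by (simp add: x_def powr_minus inverse_powr)
  ultimately show "(\<lambda>k. ln (real (info_complexity (\<epsilon> k) (d k))) / (\<epsilon> k powr (- s) + real (d k) powr t)) \<longlonglongrightarrow> 0"
    by (simp add: r_def z_def D_def)
qed

end
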